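(* Let $d\in\mathbb N$, $a\in\mathbb N_0$. For every $m\in\mathbb N_0$, as formal power series in $t$, $$\sum_{n=m}^{\infty}S2(d,a;n,m)\,\frac{t^n}{n!}=e^{a\,t}\,\frac{(e^{d\,t}-1)^m}{m!}.$$
   Context: $\mathbb N=\{1,2,\dots\}$, $\mathbb N_0=\{0,1,2,\dots\}$. The generalized Stirling numbers of the second kind $S2(d,a;n,m)$, $0\le m\le n$, are defined by the operator identity $(a\,\mathbf 1+d\,\mathbf E_x)^n=\sum_{m=0}^n S2(d,a;n,m)\,x^m\,\mathbf d_x^{\,m}$, where $\mathbf d_x$ is differentiation with respect to $x$, $\mathbf E_x:=x\,\mathbf d_x$ and $\mathbf 1$ is the identity operator. *)

theory Defs
  imports "HOL-Computational_Algebra.Computational_Algebra"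
begin

(* Operators act on real polynomials in x; there an operator of the form
   (sum over m of c m * x^m * d_x^m) determines its coefficients, see normal_order_unique. *)

definition euler_op :: "real poly \<Rightarrow> real poly" where
  "euler_op p = [:0, 1:] * pderiv p"

definition affine_euler_op :: "nat \<Rightarrow> nat \<Rightarrow> real poly \<Rightarrow> real poly" where
  "affine_euler_op d a p = smult (of_nat a) p + smult (of_nat d) (euler_op p)"

(* c lists the coefficients of the n-th power of a 1 + d E_x for m = 0, ..., n;
   it is set to 0 for m > n, so that c is uniquely determined as a function on nat. *)
definition is_normal_order :: "nat \<Rightarrow> nat \<Rightarrow> nat \<Rightarrow> (nat \<Rightarrow> real) \<Rightarrow> bool" where
  "is_normal_order d a n c \<longleftrightarrow>
     (\<forall>p. (affine_euler_op d a ^^ n) p = (\<Sum>m\<le>n. smult (c m) ([:0, 1:] ^ m * (pderiv ^^ m) p))) \<and>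
     (\<forall>m>n. c m = 0)"

definition S2 :: "nat \<Rightarrow> nat \<Rightarrow> nat \<Rightarrow> nat \<Rightarrow> real" where
  "S2 d a n = (THE c. is_normal_order d a n c)"

lemma normal_order_unique:
  assumes "is_normal_order d a n c" and "is_normal_order d a n c'"
  shows "c = c'"
proof
  have X: "[:0, 1:] ^ m = (monom 1 m :: real poly)" for m
    by (simp add: monom_altdef)
  have eq: "(\<Sum>m\<le>n. smult (c m) (monom 1 m * (pderiv ^^ m) p))
          = (\<Sum>m\<le>n. smult (c' m) (monom 1 m * (pderiv ^^ m) p))" for p
    using assms by (simp add: is_normal_order_def X)
  fix k
  show "c k = c' k"
  proof (induction k rule: less_induct)
    case (less k)
    show ?case
    proof (cases "k \<le> n")
      case False
      then show ?thesis using assms by (simp add: is_normal_order_def)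
    next
      case True
      let ?g = "\<lambda>b m. b m * coeff (monom 1 m * (pderiv ^^ m) (monom (1::real) k)) k"
      have split: "(\<Sum>m\<le>n. ?g b m) = (\<Sum>m<k. ?g b m) + ?g b k" for b :: "nat \<Rightarrow> real"
      proof -
        have "(\<Sum>m\<le>n. ?g b m) = (\<Sum>m\<le>k. ?g b m)"
          using True by (intro sum.mono_neutral_right) (auto simp: coeff_monom_mult)
        then show ?thesis by (simp flip: lessThan_Suc_atMost)
      qed
      have "(\<Sum>m\<le>n. ?g c m) = (\<Sum>m\<le>n. ?g c' m)"
        using arg_cong[OF eq[of "monom 1 k"], of "\<lambda>p. coeff p k"] by (simp add: coeff_sum)
      moreover have "(\<Sum>m<k. ?g c m) = (\<Sum>m<k. ?g c' m)"
        using less by (intro sum.cong) auto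
      ultimately have "?g c k = ?g c' k" by (simp add: split)
      moreover have "coeff (monom 1 k * (pderiv ^^ k) (monom (1::real) k)) k \<noteq> 0"
        by (simp add: coeff_monom_mult coeff_higher_pderiv pochhammer_fact[symmetric])
      ultimately show ?thesis by simp
    qed
  qed
qed

lemma affine_euler_op_term:
  "affine_euler_op d a (smult b ([:0, 1:] ^ m * (pderiv ^^ m) p))
   = smult ((of_nat a + of_nat d * of_nat m) * b) ([:0, 1:] ^ m * (pderiv ^^ m) p)
     + smult (of_nat d * b) ([:0, 1:] ^ Suc m * (pderiv ^^ Suc m) p)"
proof -
  define x :: "real poly" where "x = [:0, 1:]"
  define q where "q = (pderiv ^^ m) p"
  have dx: "pderiv x = 1" by (simp add: x_def pderiv_pCons)
  have dxm: "x * pderiv (x ^ m) = smult (of_nat m) (x ^ m)"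
  proof (cases m)
    case (Suc k)
    show ?thesis
      unfolding Suc pderiv_power_Suc dx by (simp only: mult_smult_right mult_1_right power_Suc)
  qed simp
  have "euler_op (x ^ m * q) = x ^ Suc m * pderiv q + x * pderiv (x ^ m) * q"
    by (simp add: euler_op_def pderiv_mult distrib_left mult_ac flip: x_def)
  then have E: "euler_op (x ^ m * q) = x ^ Suc m * pderiv q + smult (of_nat m) (x ^ m * q)"
    by (simp only: dxm mult_smult_left)
  have "affine_euler_op d a (smult b t)
      = smult (of_nat a * b) t + smult (of_nat d * b) (euler_op t)" for t
    by (simp add: affine_euler_op_def euler_op_def pderiv_smult)
  from this[of "x ^ m * q"] have "affine_euler_op d a (smult b (x ^ m * q))
      = smult ((of_nat a + of_nat d * of_nat m) * b) (x ^ m * q)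
        + smult (of_nat d * b) (x ^ Suc m * pderiv q)"
    unfolding E by (simp only: smult_add_right smult_add_left smult_smult distrib_left distrib_right add_ac mult_ac)
  then show ?thesis
    unfolding x_def q_def by (simp only: funpow.simps comp_apply)
qed

lemma affine_euler_op_sum:
  "affine_euler_op d a (sum f A) = (\<Sum>i\<in>A. affine_euler_op d a (f i))"
proof -
  have "affine_euler_op d a 0 = 0"
    "affine_euler_op d a (p + q) = affine_euler_op d a p + affine_euler_op d a q" for p q
    by (simp_all add: affine_euler_op_def euler_op_def pderiv_add smult_add_right distrib_left
        del: mult_pCons_left)
  then show ?thesis by (induction A rule: infinite_finite_induct) simp_all
qed

lemma normal_order_exists: "\<exists>c. is_normal_order d a n c"
proof (induction n)
  case 0
  show ?case
    by (rule exI[of _ "\<lambda>m. if m = 0 then 1 else 0"]) (simp add: is_normal_order_def)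
next
  case (Suc n)
  then obtain c where c: "is_normal_order d a n c" ..
  define A where "A = (\<lambda>m. (of_nat a + of_nat d * of_nat m) * c m)"
  define B where "B = (\<lambda>m. case m of 0 \<Rightarrow> 0 | Suc j \<Rightarrow> of_nat d * c j)"
  have 0: "A (Suc n) = 0" "B 0 = 0" "\<And>j. B (Suc j) = of_nat d * c j"
    using c by (simp_all add: A_def B_def is_normal_order_def)
  have "(affine_euler_op d a ^^ Suc n) p
      = (\<Sum>m\<le>Suc n. smult (A m + B m) ([:0, 1:] ^ m * (pderiv ^^ m) p))" for p
  proof -
    let ?t = "\<lambda>m. [:0, 1:] ^ m * (pderiv ^^ m) p"
    have "(affine_euler_op d a ^^ Suc n) p = affine_euler_op d a (\<Sum>m\<le>n. smult (c m) (?t m))"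
      using c by (simp add: is_normal_order_def)
    also have "\<dots> = (\<Sum>m\<le>n. smult (A m) (?t m)) + (\<Sum>m\<le>n. smult (B (Suc m)) (?t (Suc m)))"
      unfolding affine_euler_op_sum affine_euler_op_term A_def 0 sum.distrib ..
    also have "(\<Sum>m\<le>n. smult (A m) (?t m)) = (\<Sum>m\<le>Suc n. smult (A m) (?t m))"
      by (simp add: 0)
    also have "(\<Sum>m\<le>n. smult (B (Suc m)) (?t (Suc m))) = (\<Sum>m\<le>Suc n. smult (B m) (?t m))"
      by (simp only: sum.atMost_Suc_shift 0(2) smult_0_left add_0_left)
    finally show ?thesis by (simp only: smult_add_left sum.distrib)
  qed
  moreover have "A m + B m = 0" if "m > Suc n" for m
    using that c by (auto simp: A_def B_def is_normal_order_def split: nat.splits)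
  ultimately have "is_normal_order d a (Suc n) (\<lambda>m. A m + B m)"
    unfolding is_normal_order_def by blast
  then show ?case by blast
qed

lemma S2_is_normal_order: "is_normal_order d a n (S2 d a n)"
proof -
  have "\<exists>!c. is_normal_order d a n c"
    using normal_order_exists normal_order_unique by blast
  then show ?thesis unfolding S2_def by (rule theI')
qed

end

(* Both sides h m solve the triangular system
     (\<Sum>m\<le>k. m! * (k choose m) * h m) = exp ((a + d k) t)   for all k,
   which determines h.  For the right-hand side this is the binomial theorem for
   (1 + (exp (d t) - 1)) ^ k.  For the left-hand side, apply the defining operator identity to x^k,
   an eigenvector of a 1 + d E_x with eigenvalue a + d k. *)

theory Submission
  imports Defs
begin

lemma affine_euler_op_smult:
  "affine_euler_op d a (smult b p) = smult b (affine_euler_op d a p)"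
  by (simp add: affine_euler_op_def euler_op_def pderiv_smult smult_add_right mult.commute
      del: mult_pCons_left)

lemma affine_euler_op_monom:
  "affine_euler_op d a (monom 1 k) = smult (of_nat a + of_nat d * of_nat k) (monom 1 k)"
proof -
  have "euler_op (monom 1 k) = smult (of_nat k) (monom 1 k)"
    by (rule poly_eqI) (auto simp: euler_op_def coeff_pCons coeff_pderiv split: nat.splits)
  then show ?thesis
    by (simp add: affine_euler_op_def smult_add_left)
qed

lemma affine_euler_op_funpow_monom:
  "(affine_euler_op d a ^^ n) (monom 1 k)
     = smult ((of_nat a + of_nat d * of_nat k) ^ n) (monom 1 k)"
  by (induction n) (simp_all add: affine_euler_op_smult affine_euler_op_monom mult.commute)

text \<open>For m \<le> k, differentiating x^k m times and multiplying by x^m gives back x^k times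
  the falling factorial k(k-1)...(k-m+1), which the library expresses as a rising
  \<open>pochhammer\<close> starting at k-m+1. For m > k the factor x^m leaves no term of degree
  k.\<close>

lemma coeff_monom_mult_higher_pderiv_monom:
  "coeff (monom 1 m * (pderiv ^^ m) (monom (1::real) k)) k = fact m * of_nat (k choose m)"
proof (cases "m \<le> k")
  case True
  then have "pochhammer (1 + (real k - real m)) m = fact m * of_nat (k choose m)"
    by (simp add: binomial_gbinomial gbinomial_pochhammer' add.commute)
  with True show ?thesis
    by (simp add: coeff_monom_mult coeff_higher_pderiv of_nat_diff)
next
  case False
  then show ?thesis
    by (simp add: coeff_monom_mult)
qed

lemma S2_eq_0: "n < m \<Longrightarrow> S2 d a n m = 0"
  using S2_is_normal_order[of d a n] by (simp add: is_normal_order_def)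

lemma sum_S2_binomial:
  "(\<Sum>m\<le>k. fact m * of_nat (k choose m) * S2 d a n m) = (of_nat a + of_nat d * of_nat k) ^ n"
proof -
  let ?t = "\<lambda>m. fact m * of_nat (k choose m) * S2 d a n m"
  have X: "[:0, 1:] ^ m = (monom 1 m :: real poly)" for m
    by (simp add: monom_altdef)
  have "(affine_euler_op d a ^^ n) (monom 1 k)
      = (\<Sum>m\<le>n. smult (S2 d a n m) (monom 1 m * (pderiv ^^ m) (monom 1 k)))"
    using S2_is_normal_order[of d a n] unfolding is_normal_order_def X by blast
  from arg_cong[OF this, of "\<lambda>p. coeff p k"]
  have "(of_nat a + of_nat d * of_nat k) ^ n = (\<Sum>m\<le>n. ?t m)"
    by (simp add: affine_euler_op_funpow_monom coeff_sum coeff_monom_mult_higher_pderiv_monom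
        mult_ac)
  \<comment> \<open>The operator identity sums up to n, the triangular system up to k. Both ranges
    extend to \<open>max n k\<close>: beyond n the coefficient \<open>S2\<close> vanishes, beyond k
    the binomial does.\<close>
  also have "\<dots> = (\<Sum>m\<le>max n k. ?t m)"
    by (rule sum.mono_neutral_left) (auto simp: S2_eq_0)
  also have "\<dots> = (\<Sum>m\<le>k. ?t m)"
    by (rule sum.mono_neutral_right) auto
  finally show ?thesis ..
qed

text \<open>Forward substitution: once the values below k agree, only the diagonal term is left, and
  its coefficient k! is invertible in characteristic 0.\<close>

lemma binomial_system_unique:
  fixes f g :: "nat \<Rightarrow> 'a::field_char_0 fps"
  assumes "\<And>k. (\<Sum>m\<le>k. fps_const (fact m * of_nat (k choose m)) * f m)
              = (\<Sum>m\<le>k. fps_const (fact m * of_nat (k choose m)) * g m)"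
  shows "f k = g k"
proof (induction k rule: less_induct)
  case (less k)
  then have "(\<Sum>m<k. fps_const (fact m * of_nat (k choose m)) * f m)
           = (\<Sum>m<k. fps_const (fact m * of_nat (k choose m)) * g m)"
    by (intro sum.cong) auto
  with assms[of k] have "fps_const (fact k) * f k = fps_const (fact k) * g k"
    by (simp flip: lessThan_Suc_atMost)
  then show ?case by simp
qed

theorem mainTheorem6:
  fixes d a m :: nat
  assumes "d \<ge> 1"
  shows "(Abs_fps (\<lambda>n. if m \<le> n then S2 d a n m / fact n else 0) :: real fps)
       = fps_exp (of_nat a) * ((fps_exp (of_nat d) - 1) ^ m * fps_const (1 / fact m))"
\<comment> \<open>Both sides are read as sequences of power series indexed by \<open>m\<close>, with
  \<open>d\<close> and \<open>a\<close> fixed.\<close>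
proof (rule binomial_system_unique)
  fix k
  let ?c = "\<lambda>m. fps_const (fact m * of_nat (k choose m)) :: real fps"
  let ?e = "fps_exp (of_nat a + of_nat d * of_nat k) :: real fps"
  have "(\<Sum>m\<le>k. ?c m * Abs_fps (\<lambda>n. if m \<le> n then S2 d a n m / fact n else 0)) = ?e"
  proof (rule fps_ext)
    fix n
    have "(\<Sum>m\<le>k. ?c m * Abs_fps (\<lambda>n. if m \<le> n then S2 d a n m / fact n else 0)) $ n
        = (\<Sum>m\<le>k. fact m * of_nat (k choose m) * S2 d a n m) / fact n"
      unfolding fps_sum_nth sum_divide_distrib
      by (intro sum.cong) (auto simp: S2_eq_0)
    then show "(\<Sum>m\<le>k. ?c m * Abs_fps (\<lambda>n. if m \<le> n then S2 d a n m / fact n else 0)) $ n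
        = ?e $ n"
      by (simp add: sum_S2_binomial)
  qed
  \<comment> \<open>Subtracting and adding 1 prepares the binomial expansion in powers of exp(d t) -
    1.\<close>
  also have "?e = fps_exp (of_nat a) * (fps_exp (of_nat d) - 1 + 1) ^ k"
    by (simp add: fps_exp_add_mult fps_exp_power_mult mult.commute)
  also have "\<dots> = (\<Sum>m\<le>k. ?c m * (fps_exp (of_nat a)
      * ((fps_exp (of_nat d) - 1) ^ m * fps_const (1 / fact m))))"
    unfolding binomial_ring sum_distrib_left
  proof (intro sum.cong refl)
    fix m
    \<comment> \<open>The factor m! in the system cancels the 1/m! of the claimed series, leaving
      the bare binomial coefficient.\<close>
    have c: "of_nat (k choose m) = ?c m * fps_const (1 / fact m)"
      by (simp add: fps_of_nat)
    show "fps_exp (of_nat a)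
        * (of_nat (k choose m) * (fps_exp (of_nat d) - 1) ^ m * 1 ^ (k - m))
      = ?c m * (fps_exp (of_nat a) * ((fps_exp (of_nat d) - 1) ^ m * fps_const (1 / fact m)))"
      unfolding c by (simp only: power_one mult_1_left mult_1_right mult_ac)
  qed
  finally show "(\<Sum>m\<le>k. ?c m * Abs_fps (\<lambda>n. if m \<le> n then S2 d a n m / fact n else 0))
      = (\<Sum>m\<le>k. ?c m * (fps_exp (of_nat a)
          * ((fps_exp (of_nat d) - 1) ^ m * fps_const (1 / fact m))))" .
qed

end
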